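(* If $\pi$ is a (fixed) total ordering pattern of length $k\ge2$, then for any positive constant $\alpha$, as $n\to\infty$, $$\mathbb{P}\big[\mathbf{C}_{n,p}\text{ contains the consecutive ordering pattern }\pi\big]\to\begin{cases}0,&\text{if } p\ll n^{-2/(k(k-1))},\\ 1-e^{-\alpha^{k(k-1)/2}},&\text{if } p\sim\alpha n^{-2/(k(k-1))},\\ 1,&\text{if } n^{-2/(k(k-1))}\ll p.\end{cases}$$
   Context: An $n$-composition is a sequence of $n$ nonnegative integers. For $p=p(n)\in[0,1)$ and $q=1-p$, the geometric random composition $\mathbf{C}_{n,p}$ is the random $n$-composition whose terms are independent, with $\mathbb{P}[\mathbf{C}_{n,p}(i)=j]=qp^j$ for every $j\ge0$ and $i\in\{1,\dots,n\}$. A total ordering pattern of length $k$ is a permutation $\pi=\pi(1)\ldots\pi(k)$ of $\{0,1,\dots,k-1\}$. The consecutive ordering pattern $\pi$ occurs at position $\ell$ in a composition $C$ if $C(\ell),\ldots,C(\ell-1+k)$ have the same relative order as $\pi(1),\ldots,\pi(k)$; that is, for all $a,b\in\{1,\dots,k\}$, $C(\ell-1+a)<C(\ell-1+b)$ iff $\pi(a)<\pi(b)$, and $C(\ell-1+a)=C(\ell-1+b)$ iff $\pi(a)=\pi(b)$. $C$ contains the pattern if it occurs at some position. For positive functions of $n$: $f\ll g$ (or $g\gg f$) means $\lim_{n\to\infty} f/g=0$, and $f\sim g$ means $\lim_{n\to\infty} f/g=1$. *)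

theory Defs
  imports "HOL-Probability.Probability" "HOL-Library.Landau_Symbols"
begin

(* An n-composition is a function on the positions {1..n}; outside these positions it has
   the default value 0, which is never inspected by the notions below.
   geometric_pmf takes the success probability q = 1 - p as its argument. *)
definition geometric_composition :: "nat \<Rightarrow> real \<Rightarrow> (nat \<Rightarrow> nat) pmf" where
  "geometric_composition n p = Pi_pmf {1..n} 0 (\<lambda>_. geometric_pmf (1 - p))"

lemma pmf_geometric_composition_term:
  assumes "0 \<le> p" "p < 1" "i \<in> {1..n}"
  shows "pmf (map_pmf (\<lambda>C. C i) (geometric_composition n p)) j = (1 - p) * p ^ j"
  using assms by (simp add: geometric_composition_def Pi_pmf_component)

lemma indep_vars_geometric_composition:
  "prob_space.indep_vars (measure_pmf (geometric_composition n p))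
     (\<lambda>_. count_space UNIV) (\<lambda>i C. C i) {1..n}"
  unfolding geometric_composition_def by (rule indep_vars_Pi_pmf) simp

definition total_ordering_pattern :: "nat \<Rightarrow> (nat \<Rightarrow> nat) \<Rightarrow> bool" where
  "total_ordering_pattern k \<pi> \<longleftrightarrow> bij_betw \<pi> {1..k} {0..<k}"

definition occurs_at :: "nat \<Rightarrow> (nat \<Rightarrow> nat) \<Rightarrow> nat \<Rightarrow> (nat \<Rightarrow> nat) \<Rightarrow> nat \<Rightarrow> bool" where
  "occurs_at k \<pi> n C l \<longleftrightarrow>
     1 \<le> l \<and> l - 1 + k \<le> n \<and>
     (\<forall>a\<in>{1..k}. \<forall>b\<in>{1..k}.
        (C (l - 1 + a) < C (l - 1 + b) \<longleftrightarrow> \<pi> a < \<pi> b) \<and>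
        (C (l - 1 + a) = C (l - 1 + b) \<longleftrightarrow> \<pi> a = \<pi> b))"

definition contains_consecutive :: "nat \<Rightarrow> (nat \<Rightarrow> nat) \<Rightarrow> nat \<Rightarrow> (nat \<Rightarrow> nat) \<Rightarrow> bool" where
  "contains_consecutive k \<pi> n C \<longleftrightarrow> (\<exists>l. occurs_at k \<pi> n C l)"

end

theory Submission
  imports Defs
begin

text \<open>
  Let $K = k(k-1)/2$ be the sum of the entries of the pattern. In an occurrence, the entry at
  place $a$ exceeds $\pi(a)$ distinct smaller values of its window, so it is at least $\pi(a)$.
  Since a geometric term is at least $v$ with probability $p^v$, an occurrence at a given
  position has probability at most $p^K$; and when two different windows overlap, the two
  systems of lower bounds cannot coincide, so that both match with probability at most
  $p^{K+1}$ (lemma \<open>prob_overlapping_matches_le\<close>). In the other direction the window may simply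
  spell the pattern, which gives the lower bound $p^K(1-p)^k \ge p^K - k p^{K+1}$.

  Let $b_m$ be the probability that none of the first $m$ windows matches. Removing the windows
  that overlap window $m$ makes the past independent of this window, so that
  $b_{m+1} = (1 - p^K)\, b_m$ up to an error of $2k p^{K+1}$ (\<open>avoid_step\<close>). Therefore
  $b_m$ differs from $(1-p^K)^m$ by at most $2 k m p^{K+1}$ (\<open>avoid_approx\<close>). At the
  threshold, $n p^K$ tends to $\alpha^K$ and $p$ tends to $0$, so this error vanishes and
  $(1-p^K)^{n+1-k}$ tends to $e^{-\alpha^K}$.

  Below the threshold the union bound $n p^K$ is enough. Above it $p$ need not tend to $0$, and
  the bounds of the recursion are useless for $p$ bounded away from $0$. There the match
  probability is still at least $c p^K$ with a constant $c > 0$ that is uniform in $p$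
  (\<open>prob_match_ge_uniform\<close>), and about $n/k$ disjoint, hence independent windows give
  $b_{n+1-k} \le e^{-c (n p^K / k - 2)}$.
\<close>

section \<open>Products of probability mass functions\<close>

lemma prob_geometric_atLeast:
  assumes "0 \<le> p" "p < 1"
  shows "measure_pmf.prob (geometric_pmf (1 - p)) {j..} = p ^ j"
proof -
  have "measure_pmf.prob (geometric_pmf (1 - p)) {..<j} = (\<Sum>i<j. p ^ i * (1 - p))"
    using assms by (simp add: measure_measure_pmf_finite)
  also have "\<dots> = 1 - p ^ j"
    by (simp add: one_diff_power_eq sum_distrib_right mult.commute flip: sum_distrib_left)
  finally have "measure_pmf.prob (geometric_pmf (1 - p)) (- {..<j}) = p ^ j"
    using measure_pmf.prob_compl[of "{..<j}" "geometric_pmf (1 - p)"] by (simp add: Compl_eq_Diff_UNIV)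
  moreover have "- {..<j} = {j..}" by auto
  ultimately show ?thesis by simp
qed

lemma prob_geometric_atLeastLessThan:
  assumes "0 \<le> p" "p < 1"
  shows "measure_pmf.prob (geometric_pmf (1 - p)) {j..<j + m} = p ^ j * (1 - p ^ m)"
proof -
  have "{j..<j + m} = {j..} - {j + m..}" by auto
  hence "measure_pmf.prob (geometric_pmf (1 - p)) {j..<j + m} = p ^ j - p ^ (j + m)"
    using assms by (simp add: measure_pmf.finite_measure_Diff prob_geometric_atLeast)
  thus ?thesis by (simp add: algebra_simps power_add)
qed

lemma prob_Pi_pmf_subset:
  assumes "finite S" "I \<subseteq> S"
  shows "measure_pmf.prob (Pi_pmf S d \<mu>) {C. \<forall>i\<in>I. C i \<in> A i} =
           (\<Prod>i\<in>I. measure_pmf.prob (\<mu> i) (A i))"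
proof -
  define B where "B i = (if i \<in> I then A i else UNIV)" for i
  have "{C. \<forall>i\<in>I. C i \<in> A i} = Pi S B"
    using assms by (auto simp: B_def Pi_def)
  hence "measure_pmf.prob (Pi_pmf S d \<mu>) {C. \<forall>i\<in>I. C i \<in> A i} =
      (\<Prod>i\<in>S. measure_pmf.prob (\<mu> i) (B i))"
    using assms by (simp add: measure_Pi_pmf_Pi)
  also have "\<dots> = (\<Prod>i\<in>I. measure_pmf.prob (\<mu> i) (B i))"
    using assms by (intro prod.mono_neutral_right) (auto simp: B_def)
  finally show ?thesis by (simp add: B_def)
qed

text \<open>
  Events that can be read off from the coordinates in \<open>I\<close>. One implication between
  \<open>C\<close> and \<open>C'\<close> suffices, as their roles can be exchanged.
\<close>

definition determined_by :: "('a \<Rightarrow> 'b) set \<Rightarrow> 'a set \<Rightarrow> bool" where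
  "determined_by A I \<longleftrightarrow> (\<forall>C C'. (\<forall>i\<in>I. C i = C' i) \<longrightarrow> C \<in> A \<longrightarrow> C' \<in> A)"

lemma determined_byD:
  "determined_by A I \<Longrightarrow> (\<And>i. i \<in> I \<Longrightarrow> C i = C' i) \<Longrightarrow> C \<in> A \<longleftrightarrow> C' \<in> A"
  unfolding determined_by_def by metis

lemma prob_pair_pmf_Times:
  "measure_pmf.prob (pair_pmf M N) (A \<times> B) = measure_pmf.prob M A * measure_pmf.prob N B"
proof -
  have "emeasure (pair_pmf M N) (A \<times> B) = (\<integral>\<^sup>+x. indicator (A \<times> B) x \<partial>pair_pmf M N)"
    by simp
  also have "\<dots> = (\<integral>\<^sup>+a. \<integral>\<^sup>+b. indicator A a * indicator B b \<partial>N \<partial>M)"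
    by (simp add: nn_integral_pair_pmf' indicator_times)
  also have "\<dots> = emeasure M A * emeasure N B"
    by (simp add: nn_integral_cmult nn_integral_multc)
  finally show ?thesis
    by (simp add: measure_pmf.emeasure_eq_measure flip: ennreal_mult)
qed

text \<open>
  A product over \<open>S\<close> is the image of the pair of its marginals on \<open>S \<inter> I\<close>
  and \<open>S - I\<close>. Under this splitting \<open>A\<close> constrains the first component only
  and \<open>B\<close> the second only.
\<close>

lemma prob_Pi_pmf_Int_determined_by:
  assumes "finite S" "I \<inter> J = {}" "determined_by A I" "determined_by B J"
  shows "measure_pmf.prob (Pi_pmf S d \<mu>) (A \<inter> B) =
           measure_pmf.prob (Pi_pmf S d \<mu>) A * measure_pmf.prob (Pi_pmf S d \<mu>) B"
proof -
  define M where "M = Pi_pmf (S \<inter> I) d \<mu>"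
  define N where "N = Pi_pmf (S - I) d \<mu>"
  define h where "h = (\<lambda>(f, g) i. if i \<in> S \<inter> I then f i else g i :: 'b)"
  have S: "S \<inter> I \<union> (S - I) = S" by auto
  have PS: "Pi_pmf S d \<mu> = map_pmf h (pair_pmf M N)"
    using Pi_pmf_union[of "S \<inter> I" "S - I" d \<mu>] assms(1)
    unfolding S M_def N_def h_def by auto
  have outside: "C i = d" if "C \<in> set_pmf (Pi_pmf T d \<mu>)" "i \<notin> T" "finite T" for C i T
    using set_Pi_pmf_subset[of T d \<mu>] that by auto
  have hA: "h (f, g) \<in> A \<longleftrightarrow> f \<in> A" if "f \<in> set_pmf M" "g \<in> set_pmf N" for f g
    by (rule determined_byD[OF assms(3)])
       (use that assms(1) in \<open>auto simp: h_def M_def N_def outside\<close>)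
  have hB: "h (f, g) \<in> B \<longleftrightarrow> g \<in> B" if "f \<in> set_pmf M" "g \<in> set_pmf N" for f g
    by (rule determined_byD[OF assms(4)])
       (use that assms(1,2) in \<open>auto simp: h_def\<close>)
  have eq: "measure_pmf.prob (Pi_pmf S d \<mu>) X = measure_pmf.prob (pair_pmf M N) (Y \<times> Z)"
    if "\<And>f g. f \<in> set_pmf M \<Longrightarrow> g \<in> set_pmf N \<Longrightarrow> h (f, g) \<in> X \<longleftrightarrow> f \<in> Y \<and> g \<in> Z" for X Y Z
    unfolding PS measure_map_pmf
    by (rule measure_pmf.finite_measure_eq_AE) (use that in \<open>auto simp: AE_measure_pmf_iff\<close>)
  have "measure_pmf.prob (Pi_pmf S d \<mu>) (A \<inter> B) = measure_pmf.prob (pair_pmf M N) (A \<times> B)"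
    by (rule eq) (use hA hB in auto)
  moreover have "measure_pmf.prob (Pi_pmf S d \<mu>) A = measure_pmf.prob (pair_pmf M N) (A \<times> UNIV)"
    by (rule eq) (use hA in auto)
  moreover have "measure_pmf.prob (Pi_pmf S d \<mu>) B = measure_pmf.prob (pair_pmf M N) (UNIV \<times> B)"
    by (rule eq) (use hB in auto)
  ultimately show ?thesis by (simp add: prob_pair_pmf_Times)
qed

section \<open>Occurrences of a pattern\<close>

text \<open>
  A window is indexed by its offset \<open>j\<close>, that is, it consists of the positions \<open>j + 1\<close> to
  \<open>j + k\<close>, and the bound \<open>j + k \<le> n\<close> is kept apart. This makes the event independent of
  \<open>n\<close> and lets windows be counted from \<open>0\<close>.
\<close>

definition window_matches :: "nat \<Rightarrow> (nat \<Rightarrow> nat) \<Rightarrow> nat \<Rightarrow> (nat \<Rightarrow> nat) set" where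
  "window_matches k \<pi> j = {C. \<forall>a\<in>{1..k}. \<forall>b\<in>{1..k}.
     (C (j + a) < C (j + b) \<longleftrightarrow> \<pi> a < \<pi> b) \<and> (C (j + a) = C (j + b) \<longleftrightarrow> \<pi> a = \<pi> b)}"

lemma determined_by_window_matches:
  "determined_by (window_matches k \<pi> j) {j + 1..j + k}"
  unfolding determined_by_def window_matches_def by auto

lemma contains_consecutive_iff:
  assumes "k \<ge> 1"
  shows "contains_consecutive k \<pi> n C \<longleftrightarrow> (\<exists>j<n + 1 - k. C \<in> window_matches k \<pi> j)"
proof
  assume "contains_consecutive k \<pi> n C"
  then obtain l where "occurs_at k \<pi> n C l" by (auto simp: contains_consecutive_def)
  hence "l - 1 < n + 1 - k" "C \<in> window_matches k \<pi> (l - 1)"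
    by (auto simp: occurs_at_def window_matches_def)
  thus "\<exists>j<n + 1 - k. C \<in> window_matches k \<pi> j" by blast
next
  assume "\<exists>j<n + 1 - k. C \<in> window_matches k \<pi> j"
  then obtain j where "j < n + 1 - k" "C \<in> window_matches k \<pi> j" by blast
  hence "occurs_at k \<pi> n C (j + 1)"
    by (auto simp: occurs_at_def window_matches_def)
  thus "contains_consecutive k \<pi> n C" by (auto simp: contains_consecutive_def)
qed

text \<open>
  The \<open>\<pi> a\<close> places of the window at which the pattern is smaller than \<open>\<pi> a\<close> carry
  distinct natural numbers below \<open>C (j + a)\<close>.
\<close>

lemma window_matches_ge:
  assumes "total_ordering_pattern k \<pi>" "C \<in> window_matches k \<pi> j" "a \<in> {1..k}"
  shows "\<pi> a \<le> C (j + a)"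
proof -
  define L where "L = {b \<in> {1..k}. \<pi> b < \<pi> a}"
  have bij: "bij_betw \<pi> {1..k} {0..<k}"
    using assms by (simp add: total_ordering_pattern_def)
  have inj: "inj_on \<pi> L"
    by (rule inj_on_subset[OF bij_betw_imp_inj_on[OF bij]]) (auto simp: L_def)
  have "\<pi> a < k" using bij_betwE[OF bij] assms(3) by auto
  have "\<pi> ` L = {0..<\<pi> a}"
  proof (intro equalityI subsetI)
    fix v assume v: "v \<in> {0..<\<pi> a}"
    hence "v \<in> \<pi> ` {1..k}" using bij \<open>\<pi> a < k\<close> by (auto simp: bij_betw_def)
    thus "v \<in> \<pi> ` L" using v by (auto simp: L_def)
  qed (auto simp: L_def)
  hence "\<pi> a = card L" using card_image[OF inj] by simp
  also have "inj_on (\<lambda>b. C (j + b)) L"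
    using inj assms(2) by (auto simp: inj_on_def L_def window_matches_def)
  hence "card L = card ((\<lambda>b. C (j + b)) ` L)" by (simp add: card_image)
  also have "\<dots> \<le> card {..<C (j + a)}"
    using assms(2,3) by (intro card_mono) (auto simp: L_def window_matches_def)
  finally show ?thesis by simp
qed

locale pattern_in_composition =
  fixes n k :: nat and \<pi> :: "nat \<Rightarrow> nat" and p :: real
  assumes k: "k \<ge> 2" and pattern: "total_ordering_pattern k \<pi>" and p: "0 \<le> p" "p < 1"
begin

abbreviation prob :: "(nat \<Rightarrow> nat) set \<Rightarrow> real" where
  "prob \<equiv> measure_pmf.prob (geometric_composition n p)"

abbreviation match :: "nat \<Rightarrow> (nat \<Rightarrow> nat) set" where
  "match \<equiv> window_matches k \<pi>"

definition weight :: nat where "weight = (\<Sum>a=1..k. \<pi> a)"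

definition avoid :: "nat \<Rightarrow> (nat \<Rightarrow> nat) set" where
  "avoid m = {C. \<forall>j<m. C \<notin> match j}"

lemma bij: "bij_betw \<pi> {1..k} {0..<k}"
  using pattern by (simp add: total_ordering_pattern_def)

lemma two_weight: "2 * weight = k * (k - 1)"
proof -
  have "weight = \<Sum>{0..<k}"
    unfolding weight_def using sum.reindex_bij_betw[OF bij, of "\<lambda>x. x"] by simp
  thus ?thesis
    using k by (simp add: Sum_Ico_nat)
qed

lemma weight_pos: "weight \<ge> 1"
proof -
  have "0 < k * (k - 1)" using k by simp
  thus ?thesis using two_weight by linarith
qed

lemma prob_ge_all:
  assumes "I \<subseteq> {1..n}"
  shows "prob {C. \<forall>i\<in>I. g i \<le> C i} = p ^ (\<Sum>i\<in>I. g i)"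
  using prob_Pi_pmf_subset[OF _ assms, of 0 "\<lambda>_. geometric_pmf (1 - p)" "\<lambda>i. {g i..}"] p
  by (simp add: geometric_composition_def prob_geometric_atLeast power_sum)

lemma sum_window: "(\<Sum>x=j + 1..j + k. \<pi> (x - j)) = weight"
  unfolding weight_def
  by (rule sum.reindex_bij_witness[of _ "\<lambda>a. j + a" "\<lambda>x. x - j"]) auto

lemma prob_match_le:
  assumes "j + k \<le> n"
  shows "prob (match j) \<le> p ^ weight"
proof -
  have ge: "\<pi> (x - j) \<le> C x" if "C \<in> match j" "x \<in> {j + 1..j + k}" for C x
    using window_matches_ge[OF pattern that(1), of "x - j"] that(2) by (auto simp: le_diff_conv2)
  have "prob (match j) \<le> prob {C. \<forall>x\<in>{j + 1..j + k}. \<pi> (x - j) \<le> C x}"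
    by (rule measure_pmf.finite_measure_mono) (use ge in auto)
  also have "\<dots> = p ^ weight"
    using assms by (subst prob_ge_all) (auto simp: sum_window[simplified])
  finally show ?thesis .
qed

text \<open>
  If both windows match, then every term is at least the maximum of the bounds that the two
  windows impose on it. The bounds from either window alone add up to \<open>weight\<close>, so it suffices
  to find a place where the later window imposes the larger bound. If the pattern does not end in
  its minimum, the last place of the later window will do, being outside the earlier one. If it
  does, the last place of the earlier window will do: there the earlier bound is \<open>0\<close> and the
  later one is not, because \<open>\<pi>\<close> attains \<open>0\<close> only once.
\<close>

lemma prob_overlapping_matches_le:
  assumes "i < j" "j < i + k" "j + k \<le> n"
  shows "prob (match i \<inter> match j) \<le> p ^ (weight + 1)"
proof -
  \<comment> \<open>The lower bound that a match at offset \<open>h\<close> imposes on position \<open>x\<close>.\<close>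
  define f where "f h x = (if x \<in> {h + 1..h + k} then \<pi> (x - h) else 0)" for h x
  define I where "I = {i + 1..j + k}"
  have ge: "f h x \<le> C x" if "C \<in> match h" for C h x
    using window_matches_ge[OF pattern that, of "x - h"] by (auto simp: f_def le_diff_conv2)
  have sum_f: "(\<Sum>x\<in>I. f i x) = weight"
    unfolding I_def sum_window[of i, symmetric] f_def
    using assms by (intro sum.mono_neutral_cong_right) auto
  have "\<exists>x\<in>I. f i x < f j x"
  proof (cases "\<pi> k = 0")
    case False
    thus ?thesis using assms k by (intro bexI[of _ "j + k"]) (auto simp: f_def I_def)
  next
    case True
    have "i + k - j \<in> {1..k}" "i + k - j \<noteq> k" "k \<in> {1..k}" using assms k by auto
    hence "\<pi> (i + k - j) \<noteq> \<pi> k"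
      using bij_betw_imp_inj_on[OF bij] by (meson inj_onD)
    thus ?thesis using True assms k by (intro bexI[of _ "i + k"]) (auto simp: f_def I_def)
  qed
  hence "(\<Sum>x\<in>I. f i x) < (\<Sum>x\<in>I. max (f i x) (f j x))"
    by (intro sum_strict_mono_ex1) (auto simp: I_def less_max_iff_disj)
  hence weight: "weight + 1 \<le> (\<Sum>x\<in>I. max (f i x) (f j x))"
    using sum_f by simp
  have "prob (match i \<inter> match j) \<le> prob {C. \<forall>x\<in>I. max (f i x) (f j x) \<le> C x}"
    by (rule measure_pmf.finite_measure_mono) (use ge in auto)
  also have "\<dots> = p ^ (\<Sum>x\<in>I. max (f i x) (f j x))"
    using assms by (intro prob_ge_all) (auto simp: I_def)
  also have "\<dots> \<le> p ^ (weight + 1)"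
    using weight p by (intro power_decreasing) auto
  finally show ?thesis .
qed

text \<open>
  Cut the natural numbers into blocks of length \<open>m\<close>. If the term at place \<open>a\<close> lies in block
  number \<open>\<pi> a\<close>, the window matches. The block length is a free parameter: \<open>m = 1\<close> is sharp
  for small \<open>p\<close>, while for \<open>p\<close> near \<open>1\<close> a long block keeps the probability bounded
  away from \<open>0\<close>.
\<close>

lemma prob_match_ge_box:
  assumes "j + k \<le> n"
  shows "(p ^ m) ^ weight * (1 - p ^ m) ^ k \<le> prob (match j)"
proof -
  define A where "A x = {m * \<pi> (x - j)..<m * \<pi> (x - j) + m}" for x
  let ?I = "{j + 1..j + k}"
  have box: "C (j + a) div m = \<pi> a" if "\<forall>x\<in>?I. C x \<in> A x" "a \<in> {1..k}" for C a
  proof -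
    have "C (j + a) \<in> A (j + a)" using that by auto
    thus ?thesis by (intro div_nat_eqI) (auto simp: A_def algebra_simps)
  qed
  have "{C. \<forall>x\<in>?I. C x \<in> A x} \<subseteq> match j"
  proof
    fix C assume "C \<in> {C. \<forall>x\<in>?I. C x \<in> A x}"
    hence C: "\<forall>x\<in>?I. C x \<in> A x" by simp
    have less: "C (j + a) < C (j + b)" if "\<pi> a < \<pi> b" "a \<in> {1..k}" "b \<in> {1..k}" for a b
      using that box[OF C] by (metis div_le_mono leD le_less_linear)
    have "a = b" if "\<pi> a = \<pi> b" "a \<in> {1..k}" "b \<in> {1..k}" for a b
      using that bij_betw_imp_inj_on[OF bij] by (meson inj_onD)
    with less show "C \<in> match j"
      unfolding window_matches_def by (smt (verit) linorder_neqE_nat mem_Collect_eq order_less_asym less_irrefl)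
  qed
  hence "prob {C. \<forall>x\<in>?I. C x \<in> A x} \<le> prob (match j)"
    by (intro measure_pmf.finite_measure_mono) auto
  moreover have "prob {C. \<forall>x\<in>?I. C x \<in> A x} = (\<Prod>x\<in>?I. (p ^ m) ^ \<pi> (x - j) * (1 - p ^ m))"
    unfolding geometric_composition_def using assms p
    by (subst prob_Pi_pmf_subset) (auto simp: A_def prob_geometric_atLeastLessThan power_mult)
  moreover have "\<dots> = (p ^ m) ^ weight * (1 - p ^ m) ^ k"
    by (simp add: prod.distrib sum_window[simplified] flip: power_sum)
  ultimately show ?thesis by simp
qed

lemma prob_match_ge_linear:
  assumes "j + k \<le> n"
  shows "p ^ weight - k * p ^ (weight + 1) \<le> prob (match j)"
proof -
  have "p ^ weight * (1 + real k * (- p)) \<le> p ^ weight * (1 + (- p)) ^ k"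
    using p by (intro mult_left_mono Bernoulli_inequality) auto
  thus ?thesis
    using prob_match_ge_box[OF assms, of 1] by (simp add: algebra_simps)
qed

definition uniform_const :: real where "uniform_const = (1 / 4) ^ weight * (1 / 2) ^ k"

lemma uniform_const_pos: "uniform_const > 0" by (simp add: uniform_const_def)

lemma uniform_const_le_1: "uniform_const * p ^ weight \<le> 1"
  unfolding uniform_const_def using p by (intro mult_le_one power_le_one mult_nonneg_nonneg) auto

text \<open>
  For \<open>p \<le> 1/2\<close> blocks of length \<open>1\<close> do. For larger \<open>p\<close> the least \<open>m\<close> with
  \<open>p ^ m \<le> 1/2\<close> satisfies \<open>p ^ m \<ge> p / 2 \<ge> 1/4\<close>.
\<close>

lemma prob_match_ge_uniform:
  assumes "j + k \<le> n"
  shows "uniform_const * p ^ weight \<le> prob (match j)"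
proof -
  obtain m where m: "p ^ m \<le> 1 / 2" "p ^ m \<ge> (1 / 4) * p"
  proof (cases "p \<le> 1 / 2")
    case True
    thus ?thesis using p that[of 1] by simp
  next
    case False
    define m where "m = (LEAST m. p ^ m \<le> 1 / 2)"
    obtain m' where "p ^ m' < 1 / 2" using real_arch_pow_inv[of "1/2" p] p by auto
    hence m: "p ^ m \<le> 1 / 2" unfolding m_def by (metis LeastI less_imp_le)
    hence "m \<noteq> 0" by (intro notI) simp
    then obtain l where l: "m = Suc l" by (cases m) auto
    have "\<not> p ^ l \<le> 1 / 2" using not_less_Least[of l "\<lambda>m. p ^ m \<le> 1 / 2"] l m_def by simp
    hence "p * (1 / 2) \<le> p * p ^ l" using p by (intro mult_left_mono) auto
    thus ?thesis using that[of m] m l p by simp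
  qed
  have "uniform_const * p ^ weight = ((1 / 4) * p) ^ weight * (1 / 2) ^ k"
    by (simp add: uniform_const_def power_mult_distrib power_divide)
  also have "\<dots> \<le> (p ^ m) ^ weight * (1 - p ^ m) ^ k"
    using m p by (intro mult_mono power_mono) auto
  also have "\<dots> \<le> prob (match j)" by (rule prob_match_ge_box[OF assms])
  finally show ?thesis .
qed

section \<open>Probability of avoiding the pattern\<close>

lemma determined_by_avoid:
  assumes "\<And>i. i < m \<Longrightarrow> i + k \<le> l"
  shows "determined_by (avoid m) {1..l}"
  unfolding determined_by_def avoid_def
proof (intro allI impI, simp, intro allI impI)
  fix C C' :: "nat \<Rightarrow> nat" and j
  assume eq: "\<forall>i\<in>{Suc 0..l}. C i = C' i" and C: "\<forall>j<m. C \<notin> match j" and j: "j < m"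
  have "C \<in> match j \<longleftrightarrow> C' \<in> match j"
    using assms[OF j] eq by (intro determined_byD[OF determined_by_window_matches]) auto
  thus "C' \<notin> match j" using C j by simp
qed

lemma prob_avoid_Int_match:
  assumes "\<And>i. i < m \<Longrightarrow> i + k \<le> j"
  shows "prob (avoid m \<inter> match j) = prob (avoid m) * prob (match j)"
  unfolding geometric_composition_def
  by (rule prob_Pi_pmf_Int_determined_by[OF _ _ determined_by_avoid[OF assms] determined_by_window_matches])
     auto

lemma prob_contains_consecutive:
  "prob {C. contains_consecutive k \<pi> n C} = 1 - prob (avoid (n + 1 - k))"
proof -
  have "{C. contains_consecutive k \<pi> n C} = UNIV - avoid (n + 1 - k)"
    using k by (auto simp: contains_consecutive_iff avoid_def)
  thus ?thesis using measure_pmf.prob_compl[of "avoid (n + 1 - k)"] by simp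
qed

lemma prob_Union_le:
  assumes "\<And>i. i \<in> I \<Longrightarrow> prob (F i) \<le> c" "finite I" "card I \<le> N" "0 \<le> c"
  shows "prob (\<Union>i\<in>I. F i) \<le> N * c"
proof -
  have "prob (\<Union>i\<in>I. F i) \<le> (\<Sum>i\<in>I. prob (F i))"
    using assms by (intro measure_pmf.finite_measure_subadditive_finite) auto
  also have "\<dots> \<le> card I * c" using sum_bounded_above[of I "\<lambda>i. prob (F i)" c] assms by simp
  also have "\<dots> \<le> N * c" using assms by (intro mult_right_mono) auto
  finally show ?thesis .
qed

lemma prob_Un_le: "prob (A \<union> B) \<le> prob A + prob B"
  by (rule measure_Un_le) auto

lemma prob_mono: "A \<subseteq> B \<Longrightarrow> prob A \<le> prob B"
  by (rule measure_pmf.finite_measure_mono) auto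

lemma prob_contains_consecutive_le:
  "prob {C. contains_consecutive k \<pi> n C} \<le> n * p ^ weight"
proof -
  have "prob {C. contains_consecutive k \<pi> n C} \<le> prob (\<Union>j<n + 1 - k. match j)"
    using k by (intro prob_mono) (auto simp: contains_consecutive_iff)
  also have "\<dots> \<le> n * p ^ weight"
    using p k by (intro prob_Union_le prob_match_le) auto
  finally show ?thesis .
qed

lemma avoid_Suc: "prob (avoid (Suc m)) = prob (avoid m) - prob (avoid m \<inter> match m)"
proof -
  have "avoid (Suc m) = avoid m - avoid m \<inter> match m"
    by (auto simp: avoid_def less_Suc_eq)
  thus ?thesis by (simp add: measure_pmf.finite_measure_Diff)
qed

text \<open>
  Windows with index below \<open>l = m + 1 - k\<close> are disjoint from window \<open>m\<close>, so a match of
  window \<open>m\<close> is independent of \<open>avoid l\<close>. Passing from \<open>avoid m\<close> to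
  \<open>avoid l\<close> forgets fewer than \<open>k\<close> windows. This changes the probability by at most
  \<open>k * p ^ weight\<close>, which after multiplication by the match probability is of the order of
  the error term, and on a match of window \<open>m\<close> it costs at most \<open>k\<close> overlapping pairs of
  matches.
\<close>

lemma avoid_step:
  assumes "m + k \<le> n"
  shows "\<bar>prob (avoid (Suc m)) - (1 - p ^ weight) * prob (avoid m)\<bar> \<le> 2 * k * p ^ (weight + 1)"
proof -
  define s where "s = p ^ weight"
  define e where "e = p ^ (weight + 1)"
  \<comment> \<open>Truncated subtraction is intended: for \<open>m < k\<close> every earlier window overlaps
    window \<open>m\<close>, and \<open>avoid 0\<close> is the sure event.\<close>
  define l where "l = m + 1 - k"
  define I where "I = {l..<m}"
  have I: "finite I" "card I \<le> k" by (auto simp: I_def l_def)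
  have l: "i + k \<le> m" if "i < l" for i using that by (auto simp: l_def)
  have "p ^ (weight + weight) \<le> p ^ (weight + 1)"
    using p weight_pos by (intro power_decreasing) auto
  hence s: "0 \<le> s" "0 \<le> e" "s * s \<le> e"
    using p by (auto simp: s_def e_def power_add)
  have indep: "prob (avoid l \<inter> match m) = prob (avoid l) * prob (match m)"
    using l by (rule prob_avoid_Int_match)
  have cover: "avoid l \<subseteq> avoid m \<union> (\<Union>i\<in>I. match i)"
  proof
    fix C assume C: "C \<in> avoid l"
    show "C \<in> avoid m \<union> (\<Union>i\<in>I. match i)"
    proof (cases "C \<in> avoid m")
      case False
      then obtain i where i: "i < m" "C \<in> match i" by (auto simp: avoid_def)
      hence "\<not> i < l" using C by (auto simp: avoid_def)
      thus ?thesis using i by (auto simp: I_def)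
    qed simp
  qed
  have "prob (avoid l) \<le> prob (avoid m \<union> (\<Union>i\<in>I. match i))"
    by (rule prob_mono[OF cover])
  also have "\<dots> \<le> prob (avoid m) + prob (\<Union>i\<in>I. match i)" by (rule prob_Un_le)
  also have "prob (\<Union>i\<in>I. match i) \<le> k * s"
    using I s assms unfolding s_def by (intro prob_Union_le prob_match_le) (auto simp: I_def)
  finally have close: "prob (avoid l) \<le> prob (avoid m) + k * s" by simp
  have mono: "prob (avoid m) \<le> prob (avoid l)"
    by (rule prob_mono) (use k in \<open>auto simp: avoid_def l_def\<close>)
  have "prob (avoid m \<inter> match m) \<le> prob (avoid l \<inter> match m)"
    by (rule prob_mono) (use k in \<open>auto simp: avoid_def l_def\<close>)
  also have "\<dots> \<le> (prob (avoid m) + k * s) * s"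
    unfolding indep using close prob_match_le[OF assms] s by (intro mult_mono) (auto simp: s_def)
  also have "\<dots> \<le> s * prob (avoid m) + k * e"
    using mult_left_mono[OF s(3), of "real k"] by (simp add: algebra_simps)
  finally have upper: "prob (avoid m \<inter> match m) \<le> s * prob (avoid m) + k * e" .
  have "prob (avoid l \<inter> match m) \<le> prob ((avoid m \<inter> match m) \<union> (\<Union>i\<in>I. match i \<inter> match m))"
    using cover by (intro prob_mono) auto
  also have "\<dots> \<le> prob (avoid m \<inter> match m) + prob (\<Union>i\<in>I. match i \<inter> match m)" by (rule prob_Un_le)
  also have "prob (\<Union>i\<in>I. match i \<inter> match m) \<le> k * e"
    using I s assms unfolding e_def
    by (intro prob_Union_le prob_overlapping_matches_le) (auto simp: I_def l_def)
  finally have "prob (avoid l) * prob (match m) \<le> prob (avoid m \<inter> match m) + k * e"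
    unfolding indep by simp
  moreover have "prob (avoid m) * (s - k * e) \<le> prob (avoid l) * prob (match m)"
  proof -
    have "prob (avoid m) * (s - k * e) \<le> prob (avoid m) * prob (match m)"
      using prob_match_ge_linear[OF assms] by (intro mult_left_mono) (auto simp: s_def e_def)
    also have "\<dots> \<le> prob (avoid l) * prob (match m)" using mono by (intro mult_right_mono) auto
    finally show ?thesis .
  qed
  moreover have "prob (avoid m) * (k * e) \<le> 1 * (k * e)"
    using s by (intro mult_right_mono) auto
  ultimately have lower: "s * prob (avoid m) - 2 * k * e \<le> prob (avoid m \<inter> match m)"
    by (simp add: algebra_simps)
  have "0 \<le> k * e" using s by simp
  thus ?thesis using upper lower unfolding avoid_Suc s_def[symmetric] e_def[symmetric]
    by (simp add: algebra_simps abs_le_iff)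
qed

text \<open>
  The errors of the single steps add up, because the recursion multiplies earlier errors by a
  factor in the unit interval.
\<close>

lemma avoid_approx:
  assumes "m \<le> n + 1 - k"
  shows "\<bar>prob (avoid m) - (1 - p ^ weight) ^ m\<bar> \<le> m * (2 * k * p ^ (weight + 1))"
  using assms
proof (induction m)
  case 0
  show ?case by (simp add: avoid_def)
next
  case (Suc m)
  let ?t = "1 - p ^ weight"
  define e where "e = 2 * k * p ^ (weight + 1)"
  have t: "0 \<le> ?t" "?t \<le> 1" using p by (auto simp: power_le_one)
  have "\<bar>?t * (prob (avoid m) - ?t ^ m)\<bar> \<le> 1 * \<bar>prob (avoid m) - ?t ^ m\<bar>"
    unfolding abs_mult using t by (intro mult_right_mono) auto
  moreover have "\<bar>prob (avoid m) - ?t ^ m\<bar> \<le> m * e" using Suc by (auto simp: e_def)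
  moreover have "\<bar>prob (avoid (Suc m)) - ?t * prob (avoid m)\<bar> \<le> e"
    unfolding e_def using Suc.prems by (intro avoid_step) auto
  moreover have "\<bar>prob (avoid (Suc m)) - ?t ^ Suc m\<bar> \<le>
      \<bar>prob (avoid (Suc m)) - ?t * prob (avoid m)\<bar> + \<bar>?t * (prob (avoid m) - ?t ^ m)\<bar>"
    using abs_triangle_ineq[of "prob (avoid (Suc m)) - ?t * prob (avoid m)" "?t * (prob (avoid m) - ?t ^ m)"]
    by (simp add: right_diff_distrib)
  moreover have "real (Suc m) * e = m * e + e" by (simp add: algebra_simps)
  ultimately show ?case unfolding e_def[symmetric] mult_1 by linarith
qed

text \<open>
  Each group of \<open>k\<close> further windows contains one, the last, that is disjoint from all
  windows before the group.
\<close>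

lemma avoid_disjoint_windows:
  assumes "k * i \<le> n + 1 - k"
  shows "prob (avoid (k * i)) \<le> (1 - uniform_const * p ^ weight) ^ i"
  using assms
proof (induction i)
  case (Suc i)
  define m where "m = k * i"
  let ?t = "1 - uniform_const * p ^ weight"
  define j where "j = m + k - 1"
  have mk: "k * Suc i = m + k" by (simp add: m_def)
  have j: "j + k \<le> n" using Suc.prems k unfolding mk j_def by simp
  have "avoid (m + k) \<subseteq> avoid m - avoid m \<inter> match j"
    using k by (auto simp: avoid_def j_def)
  hence "prob (avoid (m + k)) \<le> prob (avoid m - avoid m \<inter> match j)" by (rule prob_mono)
  also have "\<dots> = prob (avoid m) - prob (avoid m \<inter> match j)"
    by (simp add: measure_pmf.finite_measure_Diff)
  also have "\<dots> = prob (avoid m) * (1 - prob (match j))"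
    by (subst prob_avoid_Int_match) (use k in \<open>auto simp: j_def algebra_simps\<close>)
  also have "\<dots> \<le> ?t ^ i * ?t"
    using Suc prob_match_ge_uniform[OF j] uniform_const_le_1 by (intro mult_mono) (auto simp: m_def)
  finally show ?case unfolding mk by (simp add: mult.commute)
qed (auto simp: avoid_def)

text \<open>
  The correction \<open>- 2\<close> pays for the \<open>k - 1\<close> missing windows at the end and for rounding
  down to a whole number of groups.
\<close>

lemma prob_avoid_le_exp:
  "prob (avoid (n + 1 - k)) \<le> exp (- (uniform_const * (n * p ^ weight / k - 2)))"
proof -
  define m where "m = n + 1 - k"
  define i where "i = m div k"
  define c where "c = uniform_const * p ^ weight"
  have s: "p ^ weight \<le> 1" using p by (simp add: power_le_one)
  have "0 \<le> 1 - c" using uniform_const_le_1 by (simp add: c_def)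
  have "m < k * (i + 1)"
    using k unfolding i_def by (simp add: dividend_less_times_div)
  hence "n \<le> k * (i + 2)" by (simp add: m_def)
  hence "real n \<le> real (k * (i + 2))" by (rule of_nat_mono)
  hence n: "n / k - 2 \<le> i" using k by (simp add: field_simps)
  have "n * p ^ weight / k - 2 \<le> p ^ weight * (n / k - 2)"
    using s by (simp add: algebra_simps)
  also have "\<dots> \<le> p ^ weight * i" using n p by (intro mult_left_mono) auto
  finally have *: "uniform_const * (n * p ^ weight / k - 2) \<le> uniform_const * (p ^ weight * i)"
    using uniform_const_pos by simp
  have "prob (avoid m) \<le> prob (avoid (k * i))"
  proof (rule prob_mono)
    have "k * i \<le> m" by (simp add: i_def)
    thus "avoid m \<subseteq> avoid (k * i)" by (auto simp: avoid_def)
  qed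
  also have "\<dots> \<le> (1 - c) ^ i"
    unfolding c_def by (rule avoid_disjoint_windows) (simp add: i_def m_def)
  also have "\<dots> \<le> exp (- c) ^ i"
    using \<open>0 \<le> 1 - c\<close> exp_ge_add_one_self[of "- c"] by (intro power_mono) auto
  also have "\<dots> = exp (- (uniform_const * (p ^ weight * i)))"
    by (simp add: c_def flip: exp_of_nat_mult)
  also have "\<dots> \<le> exp (- (uniform_const * (n * p ^ weight / k - 2)))"
    using * by simp
  finally show ?thesis by (simp add: m_def)
qed

end

section \<open>Asymptotics\<close>

lemma tendsto_one_minus_power:
  fixes s :: "nat \<Rightarrow> real" and m :: "nat \<Rightarrow> nat"
  assumes s: "s \<longlonglongrightarrow> 0" and ms: "(\<lambda>n. m n * s n) \<longlonglongrightarrow> L"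
  shows "(\<lambda>n. (1 - s n) ^ m n) \<longlonglongrightarrow> exp (- L)"
proof (rule tendsto_sandwich)
  have ev: "\<forall>\<^sub>F n in sequentially. s n < 1" using s by (rule order_tendstoD) simp
  show "\<forall>\<^sub>F n in sequentially. (1 - s n) ^ m n \<le> exp (- (m n * s n))"
    using ev
  proof eventually_elim
    case (elim n)
    hence "(1 - s n) ^ m n \<le> exp (- s n) ^ m n"
      using exp_ge_add_one_self[of "- s n"] by (intro power_mono) auto
    thus ?case by (simp flip: exp_of_nat_mult)
  qed
  show "\<forall>\<^sub>F n in sequentially. exp (- (m n * s n / (1 - s n))) \<le> (1 - s n) ^ m n"
    using ev
  proof eventually_elim
    case (elim n)
    have "1 / (1 - s n) \<le> exp (s n / (1 - s n))"
      using exp_ge_add_one_self[of "s n / (1 - s n)"] elim by (simp add: field_simps)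
    hence "exp (- (s n / (1 - s n))) \<le> 1 - s n"
      using elim by (simp add: exp_minus field_simps)
    hence "exp (- (s n / (1 - s n))) ^ m n \<le> (1 - s n) ^ m n" by (intro power_mono) auto
    thus ?case by (simp flip: exp_of_nat_mult)
  qed
  have "(\<lambda>n. exp (- (m n * s n / (1 - s n)))) \<longlonglongrightarrow> exp (- (L / (1 - 0)))"
    by (intro tendsto_intros s ms) auto
  thus "(\<lambda>n. exp (- (m n * s n / (1 - s n)))) \<longlonglongrightarrow> exp (- L)" by simp
  show "(\<lambda>n. exp (- (m n * s n))) \<longlonglongrightarrow> exp (- L)"
    by (intro tendsto_intros ms)
qed

theorem proposition4p17:
  fixes k :: nat and \<pi> :: "nat \<Rightarrow> nat" and p :: "nat \<Rightarrow> real" and \<alpha> :: real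
  defines "threshold \<equiv> \<lambda>n::nat. real n powr (- 2 / (real k * (real k - 1)))"
    and "P \<equiv> \<lambda>n. measure_pmf.prob (geometric_composition n (p n))
                  {C. contains_consecutive k \<pi> n C}"
  assumes "k \<ge> 2" and "total_ordering_pattern k \<pi>"
    and "\<alpha> > 0"
    and "\<And>n. 0 \<le> p n \<and> p n < 1"
  shows "(p \<in> o[at_top](threshold) \<longrightarrow> P \<longlonglongrightarrow> 0) \<and>
         (p \<sim>[at_top] (\<lambda>n. \<alpha> * threshold n) \<longrightarrow>
            P \<longlonglongrightarrow> 1 - exp (- (\<alpha> powr (real k * (real k - 1) / 2)))) \<and>
         (threshold \<in> o[at_top](p) \<longrightarrow> P \<longlonglongrightarrow> 1)"
proof -
  interpret pattern_in_composition n k \<pi> "p n" for n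
    by unfold_locales (use assms in auto)
  note p = assms(6)
  let ?avoid = "\<lambda>n. measure_pmf.prob (geometric_composition n (p n)) (avoid (n + 1 - k))"
  define u where "u n = n * p n ^ weight" for n
  have P: "P n = 1 - ?avoid n" for n
    unfolding P_def by (rule prob_contains_consecutive)
  have real_weight: "real k * (real k - 1) = 2 * real weight"
  proof -
    have "real (2 * weight) = real (k * (k - 1))" by (simp only: two_weight)
    thus ?thesis using assms(3) by (simp add: of_nat_diff)
  qed
  have threshold_pos: "threshold n > 0" if "n > 0" for n
    using that by (simp add: threshold_def)
  \<comment> \<open>The threshold is the solution of \<open>n * p ^ weight = 1\<close>, so each of the three
    regimes is a statement about the limit of \<open>u\<close>.\<close>
  have threshold_power: "threshold n ^ weight = 1 / n" if "n > 0" for n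
  proof -
    have "threshold n ^ weight = n powr (- 2 / (2 * real weight) * real weight)"
      unfolding threshold_def real_weight using that by (simp add: powr_powr flip: powr_realpow)
    also have "- 2 / (2 * real weight) * real weight = - 1" using weight_pos by simp
    finally show ?thesis using that by (simp add: powr_minus field_simps)
  qed
  have u: "(p n / threshold n) ^ weight = u n" if "n > 0" for n
    using threshold_power[OF that] by (simp add: u_def power_divide)
  have ev_pos: "\<forall>\<^sub>F n::nat in sequentially. n > 0" by (rule eventually_gt_at_top)
  have limit_u: "u \<longlonglongrightarrow> x ^ weight" if "(\<lambda>n. p n / threshold n) \<longlonglongrightarrow> x" for x
  proof (rule Lim_transform_eventually)
    show "(\<lambda>n. (p n / threshold n) ^ weight) \<longlonglongrightarrow> x ^ weight" by (intro tendsto_intros that)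
    show "\<forall>\<^sub>F n in sequentially. (p n / threshold n) ^ weight = u n"
      using ev_pos by eventually_elim (rule u)
  qed
  have "P \<longlonglongrightarrow> 0" if "p \<in> o(threshold)"
  proof (rule tendsto_sandwich)
    show "\<forall>\<^sub>F n in sequentially. 0 \<le> P n" by (simp add: P_def)
    show "(\<lambda>_. 0) \<longlonglongrightarrow> (0 :: real)" by simp
    show "u \<longlonglongrightarrow> 0"
      using limit_u[OF smalloD_tendsto[OF that]] weight_pos by (simp add: power_0_left)
    show "\<forall>\<^sub>F n in sequentially. P n \<le> u n"
      unfolding u_def P_def by (intro always_eventually allI prob_contains_consecutive_le)
  qed
  moreover have "P \<longlonglongrightarrow> 1 - exp (- (\<alpha> powr (real k * (real k - 1) / 2)))"
    if asymp: "p \<sim>[at_top] (\<lambda>n. \<alpha> * threshold n)"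
  proof -
    have "(\<lambda>n. \<alpha> * (if p n = 0 \<and> \<alpha> * threshold n = 0 then 1 else p n / (\<alpha> * threshold n))) \<longlonglongrightarrow> \<alpha> * 1"
      by (intro tendsto_intros asymp_equivD[OF asymp])
    moreover have "\<forall>\<^sub>F n in sequentially.
      \<alpha> * (if p n = 0 \<and> \<alpha> * threshold n = 0 then 1 else p n / (\<alpha> * threshold n)) = p n / threshold n"
      using ev_pos
    proof eventually_elim
      case (elim n)
      thus ?case using threshold_pos[of n] \<open>\<alpha> > 0\<close> by simp
    qed
    ultimately have "(\<lambda>n. p n / threshold n) \<longlonglongrightarrow> \<alpha> * 1"
      by (rule Lim_transform_eventually)
    hence x: "(\<lambda>n. p n / threshold n) \<longlonglongrightarrow> \<alpha>" by simp
    define L where "L = \<alpha> ^ weight"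
    have uL: "u \<longlonglongrightarrow> L" unfolding L_def by (rule limit_u[OF x])
    have "threshold \<longlonglongrightarrow> 0" unfolding threshold_def
      using weight_pos unfolding real_weight
      by (intro tendsto_neg_powr filterlim_real_sequentially) auto
    hence "(\<lambda>n. p n / threshold n * threshold n) \<longlonglongrightarrow> \<alpha> * 0" by (intro tendsto_intros x)
    moreover have "\<forall>\<^sub>F n in sequentially. p n / threshold n * threshold n = p n"
      using ev_pos
    proof eventually_elim
      case (elim n)
      thus ?case using threshold_pos[of n] by simp
    qed
    ultimately have "p \<longlonglongrightarrow> \<alpha> * 0" by (rule Lim_transform_eventually)
    hence p0: "p \<longlonglongrightarrow> 0" by simp
    have s0: "(\<lambda>n. p n ^ weight) \<longlonglongrightarrow> 0"
      using tendsto_power[OF p0, of weight] weight_pos by (simp add: power_0_left)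
    have "(\<lambda>n. u n - (real k - 1) * p n ^ weight) \<longlonglongrightarrow> L - (real k - 1) * 0"
      by (intro tendsto_intros uL s0)
    moreover have "\<forall>\<^sub>F n in sequentially.
        u n - (real k - 1) * p n ^ weight = real (n + 1 - k) * p n ^ weight"
      using eventually_ge_at_top[of k]
      by eventually_elim (auto simp: u_def of_nat_diff algebra_simps)
    ultimately have "(\<lambda>n. real (n + 1 - k) * p n ^ weight) \<longlonglongrightarrow> L - (real k - 1) * 0"
      by (rule Lim_transform_eventually)
    hence ms: "(\<lambda>n. real (n + 1 - k) * p n ^ weight) \<longlonglongrightarrow> L" by simp
    have main: "(\<lambda>n. (1 - p n ^ weight) ^ (n + 1 - k)) \<longlonglongrightarrow> exp (- L)"
      by (rule tendsto_one_minus_power[OF s0 ms])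
    have "(\<lambda>n. ?avoid n - (1 - p n ^ weight) ^ (n + 1 - k)) \<longlonglongrightarrow> 0"
    proof (rule Lim_null_comparison)
      show "\<forall>\<^sub>F n in sequentially. norm (?avoid n - (1 - p n ^ weight) ^ (n + 1 - k))
              \<le> real (n + 1 - k) * p n ^ weight * (2 * k * p n)"
        using avoid_approx[OF order_refl] by (intro always_eventually allI) (simp add: algebra_simps)
      have "(\<lambda>n. real (n + 1 - k) * p n ^ weight * (2 * k * p n)) \<longlonglongrightarrow> L * (real (2 * k) * 0)"
        by (intro tendsto_intros ms p0)
      thus "(\<lambda>n. real (n + 1 - k) * p n ^ weight * (2 * k * p n)) \<longlonglongrightarrow> 0" by simp
    qed
    from tendsto_add[OF this main] have "?avoid \<longlonglongrightarrow> exp (- L)" by simp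
    hence "P \<longlonglongrightarrow> 1 - exp (- L)" unfolding P by (intro tendsto_intros)
    moreover have "\<alpha> powr (real k * (real k - 1) / 2) = L"
      unfolding real_weight L_def using \<open>\<alpha> > 0\<close> by (simp add: powr_realpow)
    ultimately show ?thesis by simp
  qed
  moreover have "P \<longlonglongrightarrow> 1" if o: "threshold \<in> o(p)"
  proof -
    have "(\<lambda>n. (threshold n / p n) ^ weight) \<longlonglongrightarrow> 0 ^ weight"
      by (intro tendsto_intros smalloD_tendsto[OF o])
    hence lim: "(\<lambda>n. (threshold n / p n) ^ weight) \<longlonglongrightarrow> 0"
      using weight_pos by (simp add: power_0_left)
    have "\<forall>\<^sub>F n in sequentially. norm (threshold n) \<le> 1 * norm (p n)"
      by (rule landau_o.smallD[OF o]) simp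
    hence ev_p: "\<forall>\<^sub>F n in sequentially. 0 < threshold n \<and> 0 < p n" using ev_pos
    proof eventually_elim
      case (elim n)
      thus ?case using threshold_pos[of n] p[of n] by auto
    qed
    have "filterlim (\<lambda>n. inverse ((threshold n / p n) ^ weight)) at_top sequentially"
      using lim ev_p by (intro filterlim_inverse_at_top) (auto elim!: eventually_mono)
    moreover have "\<forall>\<^sub>F n in sequentially. inverse ((threshold n / p n) ^ weight) = u n"
      using ev_pos by eventually_elim (simp flip: u add: power_divide)
    ultimately have "filterlim u at_top sequentially"
      by (simp cong: filterlim_cong)
    hence "filterlim (\<lambda>n. - (2 * uniform_const) + uniform_const / k * u n) at_top sequentially"
      using uniform_const_pos assms(3)
      by (intro filterlim_tendsto_add_at_top[OF tendsto_const]
            filterlim_tendsto_pos_mult_at_top[OF tendsto_const]) auto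
    hence "filterlim (\<lambda>n. uniform_const * (u n / k - 2)) at_top sequentially"
      by (simp add: algebra_simps)
    hence "(\<lambda>n. exp (- (uniform_const * (u n / k - 2)))) \<longlonglongrightarrow> 0"
      by (intro filterlim_compose[OF exp_at_bot] filterlim_compose[OF filterlim_uminus_at_bot_at_top])
    hence "?avoid \<longlonglongrightarrow> 0"
      by (rule tendsto_sandwich[rotated 3])
         (use prob_avoid_le_exp in \<open>auto simp: u_def\<close>)
    from tendsto_diff[OF tendsto_const this, of 1] show ?thesis unfolding P by simp
  qed
  ultimately show ?thesis by blast
qed

end
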